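(* Let $n=2^{\alpha_0}p_1^{\alpha_1}\cdots p_r^{\alpha_r}$ with $r\geq 0$, where $p_1,\dots,p_r$ are distinct odd primes and $\alpha_0,\alpha_1,\dots,\alpha_r$ are non-negative integers. If $\alpha_0\geq 4$, or there exists $i\in\{1,\dots,r\}$ such that $\alpha_i\geq 3$, then $n\notin \bar S$.
   Context: For a finite group $G$, the (undirected) power graph $P(G)$ is the graph with vertex set $G$ in which two vertices $a,b$ are adjacent if and only if $a\neq b$ and $a^m=b$ or $b^m=a$ for some positive integer $m$. The set $\bar S$ consists of all natural numbers (positive integers) $n$ such that any two groups of order $n$ with isomorphic power graphs are isomorphic. *)

theory Defs
  imports
    "HOL-Algebra.Coset"
    "HOL-Computational_Algebra.Primes"
    "Graph_Theory.Pair_Digraph"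
    "Graph_Theory.Digraph_Isomorphism"
begin

text \<open>Following the Graph_Theory library, an undirected simple graph is a symmetric
  irreflexive set of ordered pairs over a vertex set.\<close>

definition power_graph :: "('a, 'b) monoid_scheme \<Rightarrow> 'a pair_pre_digraph" where
  "power_graph G =
     \<lparr>pverts = carrier G,
      parcs = {(a, b). a \<in> carrier G \<and> b \<in> carrier G \<and> a \<noteq> b \<and>
        (\<exists>m::nat. m > 0 \<and> (a [^]\<^bsub>G\<^esub> m = b \<or> b [^]\<^bsub>G\<^esub> m = a))}\<rparr>"

lemma power_graph_simps [simp]:
  "pverts (power_graph G) = carrier G"
  "(a, b) \<in> parcs (power_graph G) \<longleftrightarrow>
     a \<in> carrier G \<and> b \<in> carrier G \<and> a \<noteq> b \<and>
     (\<exists>m::nat. m > 0 \<and> (a [^]\<^bsub>G\<^esub> m = b \<or> b [^]\<^bsub>G\<^esub> m = a))"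
  by (simp_all add: power_graph_def)

lemma pair_graph_power_graph:
  assumes "finite (carrier G)"
  shows "pair_graph (power_graph G)"
proof -
  have sub: "parcs (power_graph G) \<subseteq> carrier G \<times> carrier G"
    by (auto simp: power_graph_def)
  have "symmetric (with_proj (power_graph G))"
    unfolding symmetric_def with_proj_simps by (rule symI) auto
  moreover have "finite (parcs (power_graph G))"
    using sub assms by (meson finite_SigmaI finite_subset)
  ultimately show ?thesis
    using assms sub by unfold_locales auto
qed

definition power_graph_iso :: "('a, 'c) monoid_scheme \<Rightarrow> ('b, 'd) monoid_scheme \<Rightarrow> bool" where
  "power_graph_iso G H \<longleftrightarrow> digraph_iso (with_proj (power_graph G)) (with_proj (power_graph H))"

text \<open>HOL cannot quantify over types inside a definition, so the groups in the next definition
  have their carriers in \<^typ>\<open>nat\<close>; every finite group is isomorphic to such a group.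
  The lemma \<open>power_graph_determined_orders_imp\<close> below shows that the property then
  holds for groups with carriers in arbitrary types.\<close>

definition power_graph_determined_orders :: "nat set" where
  "power_graph_determined_orders =
     {n. n > 0 \<and>
       (\<forall>(G :: nat monoid) (H :: nat monoid).
          group G \<and> group H \<and> order G = n \<and> order H = n \<and> power_graph_iso G H \<longrightarrow> G \<cong> H)}"

lemma digraph_iso_with_proj_iff:
  assumes "pair_wf_digraph A" "pair_wf_digraph B"
  shows "digraph_iso (with_proj A) (with_proj B) \<longleftrightarrow>
    (\<exists>f. bij_betw f (pverts A) (pverts B) \<and>
      (\<forall>u\<in>pverts A. \<forall>v\<in>pverts A. (u, v) \<in> parcs A \<longleftrightarrow> (f u, f v) \<in> parcs B))"
    (is "?L \<longleftrightarrow> ?R")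
proof -
  interpret A: pair_wf_digraph A by fact
  interpret B: pair_wf_digraph B by fact
  show ?thesis
  proof
    assume ?L
    then obtain h where h: "pre_digraph.digraph_isomorphism (with_proj A) h"
      "with_proj B = app_iso h (with_proj A)"
      unfolding digraph_iso_def by blast
    let ?f = "iso_verts h"
    have inj: "inj_on ?f (pverts A)"
      using h(1) by (simp add: pre_digraph.digraph_isomorphism_def)
    have B: "pverts B = ?f ` pverts A" "parcs B = iso_arcs h ` parcs A"
      "iso_tail h = fst" "iso_head h = snd"
      using h(2) by (auto simp: app_iso_def with_proj_def)
    have arcs: "iso_arcs h a = (?f (fst a), ?f (snd a))" if "a \<in> parcs A" for a
      using h(1) that B(3,4)
      by (auto simp: pre_digraph.digraph_isomorphism_def prod_eq_iff)
    have "(u, v) \<in> parcs A \<longleftrightarrow> (?f u, ?f v) \<in> parcs B" if "u \<in> pverts A" "v \<in> pverts A" for u v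
    proof
      assume "(u, v) \<in> parcs A"
      then show "(?f u, ?f v) \<in> parcs B" using arcs[of "(u, v)"] B(2) by force
    next
      assume "(?f u, ?f v) \<in> parcs B"
      then obtain a where a: "a \<in> parcs A" "iso_arcs h a = (?f u, ?f v)" using B(2) by force
      then have "?f (fst a) = ?f u" "?f (snd a) = ?f v" using arcs by auto
      then have "fst a = u" "snd a = v"
        using inj that A.arc_fst_in_verts[OF a(1)] A.arc_snd_in_verts[OF a(1)]
        by (auto dest: inj_onD)
      then show "(u, v) \<in> parcs A" using a(1) by (metis prod.collapse)
    qed
    then show ?R using inj B(1) by (auto simp: bij_betw_def)
  next
    assume ?R
    then obtain f where f: "bij_betw f (pverts A) (pverts B)"
      "\<And>u v. u \<in> pverts A \<Longrightarrow> v \<in> pverts A \<Longrightarrow> (u, v) \<in> parcs A \<longleftrightarrow> (f u, f v) \<in> parcs B"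
      by blast
    define h where "h = \<lparr>iso_verts = f, iso_arcs = map_prod f f, iso_head = snd, iso_tail = fst\<rparr>"
    have sub: "parcs A \<subseteq> pverts A \<times> pverts A"
      using A.in_arcsD1 A.in_arcsD2 by auto
    have inj: "inj_on f (pverts A)" using f(1) by (simp add: bij_betw_def)
    have "inj_on (map_prod f f) (parcs A)"
      by (rule inj_on_subset[OF map_prod_inj_on[OF inj inj] sub])
    then have iso: "pre_digraph.digraph_isomorphism (with_proj A) h"
      using inj A.wf_digraph_axioms
      by (auto simp: pre_digraph.digraph_isomorphism_def h_def)
    have "parcs B = map_prod f f ` parcs A"
    proof (intro equalityI subsetI)
      fix e assume e: "e \<in> parcs B"
      then have "fst e \<in> f ` pverts A" "snd e \<in> f ` pverts A"
        using B.arc_fst_in_verts B.arc_snd_in_verts f(1) by (auto simp: bij_betw_def)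
      then obtain u v where "u \<in> pverts A" "v \<in> pverts A" "e = (f u, f v)"
        by (metis imageE prod.collapse)
      then show "e \<in> map_prod f f ` parcs A" using e f(2) by force
    next
      fix e assume "e \<in> map_prod f f ` parcs A"
      then show "e \<in> parcs B" using f(2) sub by auto
    qed
    then have "with_proj B = app_iso h (with_proj A)"
      using f(1) by (simp add: app_iso_def with_proj_def h_def bij_betw_def)
    then show ?L using iso unfolding digraph_iso_def by blast
  qed
qed

lemma pair_wf_digraph_power_graph: "pair_wf_digraph (power_graph G)"
  by unfold_locales (auto simp: power_graph_def)

lemma power_graph_iso_iff:
  "power_graph_iso G H \<longleftrightarrow>
    (\<exists>f. bij_betw f (carrier G) (carrier H) \<and>
      (\<forall>u\<in>carrier G. \<forall>v\<in>carrier G.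
        (u, v) \<in> parcs (power_graph G) \<longleftrightarrow> (f u, f v) \<in> parcs (power_graph H)))"
  unfolding power_graph_iso_def
    digraph_iso_with_proj_iff[OF pair_wf_digraph_power_graph pair_wf_digraph_power_graph]
  by (simp only: power_graph_simps)

lemma power_graph_iso_sym:
  assumes "power_graph_iso G H"
  shows "power_graph_iso H G"
proof -
  obtain f where f: "bij_betw f (carrier G) (carrier H)"
    "\<And>u v. u \<in> carrier G \<Longrightarrow> v \<in> carrier G \<Longrightarrow>
      (u, v) \<in> parcs (power_graph G) \<longleftrightarrow> (f u, f v) \<in> parcs (power_graph H)"
    using assms unfolding power_graph_iso_iff by blast
  let ?g = "inv_into (carrier G) f"
  have g: "bij_betw ?g (carrier H) (carrier G)" by (rule bij_betw_inv_into[OF f(1)])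
  have "(u, v) \<in> parcs (power_graph H) \<longleftrightarrow> (?g u, ?g v) \<in> parcs (power_graph G)"
    if "u \<in> carrier H" "v \<in> carrier H" for u v
    using f(2)[of "?g u" "?g v"] that bij_betwE[OF g] bij_betw_inv_into_right[OF f(1)] by metis
  then show ?thesis unfolding power_graph_iso_iff using g by blast
qed

lemma power_graph_iso_trans:
  assumes "power_graph_iso G H" "power_graph_iso H K"
  shows "power_graph_iso G K"
proof -
  obtain f where f: "bij_betw f (carrier G) (carrier H)"
    "\<And>u v. u \<in> carrier G \<Longrightarrow> v \<in> carrier G \<Longrightarrow>
      (u, v) \<in> parcs (power_graph G) \<longleftrightarrow> (f u, f v) \<in> parcs (power_graph H)"
    using assms(1) unfolding power_graph_iso_iff by blast
  obtain g where g: "bij_betw g (carrier H) (carrier K)"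
    "\<And>u v. u \<in> carrier H \<Longrightarrow> v \<in> carrier H \<Longrightarrow>
      (u, v) \<in> parcs (power_graph H) \<longleftrightarrow> (g u, g v) \<in> parcs (power_graph K)"
    using assms(2) unfolding power_graph_iso_iff by blast
  have "(u, v) \<in> parcs (power_graph G) \<longleftrightarrow> ((g \<circ> f) u, (g \<circ> f) v) \<in> parcs (power_graph K)"
    if "u \<in> carrier G" "v \<in> carrier G" for u v
    using f(2)[OF that] g(2)[of "f u" "f v"] that bij_betwE[OF f(1)] unfolding o_def by metis
  then show ?thesis
    unfolding power_graph_iso_iff using bij_betw_trans[OF f(1) g(1)] by blast
qed

lemma power_graph_iso_if_iso:
  assumes "group G" "group H" "G \<cong> H"
  shows "power_graph_iso G H"
proof -
  interpret G: group G by fact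
  interpret H: group H by fact
  obtain f where f: "f \<in> hom G H" "bij_betw f (carrier G) (carrier H)"
    using assms(3) by (auto simp: is_iso_def iso_def)
  interpret group_hom G H f by unfold_locales (rule f(1))
  have inj: "inj_on f (carrier G)" using f(2) by (simp add: bij_betw_def)
  have "f u [^]\<^bsub>H\<^esub> m = f v \<longleftrightarrow> u [^]\<^bsub>G\<^esub> m = v"
    if "u \<in> carrier G" "v \<in> carrier G" for u v and m :: nat
    using that by (metis G.nat_pow_closed hom_nat_pow inj inj_onD)
  then show ?thesis
    unfolding power_graph_iso_iff power_graph_simps
    by (intro exI[of _ f] conjI f(2)) (use inj in \<open>auto dest: inj_onD\<close>)
qed

lemma ex_nat_group_iso:
  assumes "group G" "finite (carrier G)"
  shows "\<exists>N :: nat monoid. group N \<and> order N = order G \<and> G \<cong> N"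
proof -
  interpret G: group G by fact
  obtain f :: "_ \<Rightarrow> nat" where f: "bij_betw f (carrier G) {0..<order G}"
    using ex_bij_betw_finite_nat[OF assms(2)] by (auto simp: order_def)
  let ?g = "inv_into (carrier G) f"
  define N where "N = \<lparr>carrier = {0..<order G},
    monoid.mult = (\<lambda>x y. f (?g x \<otimes>\<^bsub>G\<^esub> ?g y)), one = f \<one>\<^bsub>G\<^esub>\<rparr>"
  have gf: "?g (f x) = x" if "x \<in> carrier G" for x
    using bij_betw_inv_into_left[OF f that] .
  have hom: "f \<in> hom G N"
    using bij_betwE[OF f] by (auto simp: hom_def N_def gf)
  have iso: "f \<in> iso G N"
    using hom f by (simp add: iso_def N_def)
  have im: "f ` carrier G = carrier N" using f by (simp add: bij_betw_def N_def)
  have "group (N\<lparr>carrier := f ` carrier G, one := f \<one>\<^bsub>G\<^esub>\<rparr>)"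
    by (rule G.hom_imp_img_group[OF hom])
  then have "group N" unfolding im by (simp add: N_def)
  moreover have "order N = order G" by (simp add: order_def N_def)
  ultimately show ?thesis using iso unfolding is_iso_def by blast
qed

lemma power_graph_determined_orders_imp:
  fixes G :: "('a, 'c) monoid_scheme" and H :: "('b, 'd) monoid_scheme"
  assumes "n \<in> power_graph_determined_orders"
    and G: "group G" "order G = n" and H: "group H" "order H = n"
    and "power_graph_iso G H"
  shows "G \<cong> H"
proof -
  interpret G: group G by fact
  interpret H: group H by fact
  have n: "n > 0" using assms(1) by (simp add: power_graph_determined_orders_def)
  then have fin: "finite (carrier G)" "finite (carrier H)"
    using G(2) H(2) by (auto simp: order_def intro: card_ge_0_finite)
  obtain M :: "nat monoid" where M: "group M" "order M = order G" "G \<cong> M"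
    using ex_nat_group_iso[OF G(1) fin(1)] by blast
  obtain N :: "nat monoid" where N: "group N" "order N = order H" "H \<cong> N"
    using ex_nat_group_iso[OF H(1) fin(2)] by blast
  have "power_graph_iso M G"
    by (rule power_graph_iso_sym[OF power_graph_iso_if_iso[OF G(1) M(1,3)]])
  moreover have "power_graph_iso H N"
    by (rule power_graph_iso_if_iso[OF H(1) N(1,3)])
  ultimately have "power_graph_iso M N"
    by (rule power_graph_iso_trans[OF power_graph_iso_trans[OF _ assms(6)]])
  then have prem: "group M \<and> group N \<and> order M = n \<and> order N = n \<and> power_graph_iso M N"
    using M(1,2) N(1,2) G(2) H(2) by (intro conjI) simp_all
  have "\<forall>(G :: nat monoid) (H :: nat monoid).
      group G \<and> group H \<and> order G = n \<and> order H = n \<and> power_graph_iso G H \<longrightarrow> G \<cong> H"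
    using assms(1) unfolding power_graph_determined_orders_def mem_Collect_eq by (rule conjunct2)
  then have "M \<cong> N"
    by (drule_tac spec[of _ M], drule_tac spec[of _ N]) (erule mp, rule prem)
  then have "G \<cong> N"
    by (rule iso_trans[OF M(3)])
  moreover have "N \<cong> H" by (rule H.iso_sym[OF N(3)])
  ultimately show ?thesis by (rule iso_trans)
qed

end

theory Submission
  imports Defs "HOL-Algebra.Elementary_Groups" "HOL-Number_Theory.Cong"
begin

text \<open>Let \<open>f\<close> be a 2-cocycle on a group \<open>V\<close> with values in an abelian group \<open>A\<close> that vanishes on
  all pairs \<open>(x\<^sup>k, x)\<close>. The central extension of \<open>V\<close> by \<open>A\<close> defined by \<open>f\<close> lives on the set
  \<open>A \<times> V\<close>, and powers in it agree with powers in the direct product; so both groups have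
  literally the same power graph. If \<open>V\<close> is abelian and \<open>f\<close> is not symmetric, one of them is
  abelian and the other is not. For \<open>p\<close> odd take \<open>V = (\<int>/p)\<^sup>2\<close>, \<open>A = \<int>/(p m)\<close> and \<open>f\<close> the determinant
  (for \<open>m = 1\<close>, the Heisenberg group); for \<open>p = 2\<close> the determinant is symmetric, so
  take \<open>V = (\<int>/2)\<^sup>2\<close>, \<open>A = \<int>/(4 m)\<close> and the cocycle of the Pauli matrices instead.\<close>

section \<open>Twisted products and their power maps\<close>

definition twisted_product ::
  "('a, 'c) monoid_scheme \<Rightarrow> ('b, 'd) monoid_scheme \<Rightarrow> ('b \<Rightarrow> 'b \<Rightarrow> 'a) \<Rightarrow> ('a \<times> 'b) monoid" where
  "twisted_product A V f =
    \<lparr>carrier = carrier A \<times> carrier V,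
     monoid.mult = (\<lambda>(a, x) (b, y). (a \<otimes>\<^bsub>A\<^esub> b \<otimes>\<^bsub>A\<^esub> f x y, x \<otimes>\<^bsub>V\<^esub> y)),
     one = (\<one>\<^bsub>A\<^esub>, \<one>\<^bsub>V\<^esub>)\<rparr>"

lemma twisted_product_simps [simp]:
  "carrier (twisted_product A V f) = carrier A \<times> carrier V"
  "(a, x) \<otimes>\<^bsub>twisted_product A V f\<^esub> (b, y) = (a \<otimes>\<^bsub>A\<^esub> b \<otimes>\<^bsub>A\<^esub> f x y, x \<otimes>\<^bsub>V\<^esub> y)"
  "\<one>\<^bsub>twisted_product A V f\<^esub> = (\<one>\<^bsub>A\<^esub>, \<one>\<^bsub>V\<^esub>)"
  by (simp_all add: twisted_product_def)

lemma DirProd_nat_pow: "(a, x) [^]\<^bsub>A \<times>\<times> V\<^esub> (k::nat) = (a [^]\<^bsub>A\<^esub> k, x [^]\<^bsub>V\<^esub> k)"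
  by (induction k) (simp_all add: nat_pow_def)

lemma DirProd_comm_group:
  assumes "comm_group A" "comm_group V"
  shows "comm_group (A \<times>\<times> V)"
proof -
  interpret A: comm_group A by fact
  interpret V: comm_group V by fact
  show ?thesis
    by (rule group.group_comm_groupI[OF DirProd_group[OF A.is_group V.is_group]])
      (auto simp: A.m_comm V.m_comm)
qed

text \<open>Adjacency refers to the group only through its power maps, so the identity map serves as
  the isomorphism.\<close>

lemma power_graph_iso_if_same_powers:
  assumes "carrier G = carrier H"
    and "\<And>x k::nat. x \<in> carrier G \<Longrightarrow> x [^]\<^bsub>G\<^esub> k = x [^]\<^bsub>H\<^esub> k"
  shows "power_graph_iso G H"
  unfolding power_graph_iso_iff
  by (rule exI[of _ id]) (simp add: assms flip: assms(1) cong: conj_cong)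

locale power_trivial_cocycle = A: comm_group A + V: group V
  for A (structure) and V (structure) +
  fixes f :: "'c \<Rightarrow> 'c \<Rightarrow> 'a"
  assumes closed [simp]: "\<lbrakk>x \<in> carrier V; y \<in> carrier V\<rbrakk> \<Longrightarrow> f x y \<in> carrier A"
    and cocycle: "\<lbrakk>x \<in> carrier V; y \<in> carrier V; z \<in> carrier V\<rbrakk> \<Longrightarrow>
      f x y \<otimes>\<^bsub>A\<^esub> f (x \<otimes>\<^bsub>V\<^esub> y) z = f y z \<otimes>\<^bsub>A\<^esub> f x (y \<otimes>\<^bsub>V\<^esub> z)"
    and pow_trivial: "x \<in> carrier V \<Longrightarrow> f (x [^]\<^bsub>V\<^esub> (k::nat)) x = \<one>\<^bsub>A\<^esub>"
begin

text \<open>The case \<open>k = 0\<close> of \<open>pow_trivial\<close> normalises the cocycle. This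
  makes the pair of units a left identity of the twisted product; \<open>groupI\<close> asks for
  left identities and left inverses.\<close>

lemma one_left [simp]: "x \<in> carrier V \<Longrightarrow> f \<one>\<^bsub>V\<^esub> x = \<one>\<^bsub>A\<^esub>"
  using pow_trivial[of x 0] by simp

lemma group_twisted_product: "group (twisted_product A V f)"
proof (rule groupI)
  fix u v w
  assume "u \<in> carrier (twisted_product A V f)" "v \<in> carrier (twisted_product A V f)"
    "w \<in> carrier (twisted_product A V f)"
  then obtain a x b y c z where
    u: "u = (a, x)" "a \<in> carrier A" "x \<in> carrier V" and
    v: "v = (b, y)" "b \<in> carrier A" "y \<in> carrier V" and
    w: "w = (c, z)" "c \<in> carrier A" "z \<in> carrier V"
    by (auto simp: twisted_product_def)
  have "a \<otimes>\<^bsub>A\<^esub> b \<otimes>\<^bsub>A\<^esub> f x y \<otimes>\<^bsub>A\<^esub> c \<otimes>\<^bsub>A\<^esub> f (x \<otimes>\<^bsub>V\<^esub> y) z =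
      a \<otimes>\<^bsub>A\<^esub> b \<otimes>\<^bsub>A\<^esub> c \<otimes>\<^bsub>A\<^esub> (f x y \<otimes>\<^bsub>A\<^esub> f (x \<otimes>\<^bsub>V\<^esub> y) z)"
    using u v w by (simp add: A.m_ac)
  also have "\<dots> = a \<otimes>\<^bsub>A\<^esub> (b \<otimes>\<^bsub>A\<^esub> c \<otimes>\<^bsub>A\<^esub> f y z) \<otimes>\<^bsub>A\<^esub> f x (y \<otimes>\<^bsub>V\<^esub> z)"
    using u v w by (simp add: cocycle A.m_ac)
  finally show "u \<otimes>\<^bsub>twisted_product A V f\<^esub> v \<otimes>\<^bsub>twisted_product A V f\<^esub> w =
      u \<otimes>\<^bsub>twisted_product A V f\<^esub> (v \<otimes>\<^bsub>twisted_product A V f\<^esub> w)"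
    using u v w by (simp add: V.m_assoc)
next
  fix u assume "u \<in> carrier (twisted_product A V f)"
  then obtain a x where u: "u = (a, x)" "a \<in> carrier A" "x \<in> carrier V"
    by (auto simp: twisted_product_def)
  \<comment> \<open>\<open>b\<close> also absorbs \<open>f (inv x) x\<close>, which
    \<open>pow_trivial\<close> does not cover: in an infinite group the inverse of \<open>x\<close>
    need not be a power with natural exponent.\<close>
  define b where "b = inv\<^bsub>A\<^esub> (a \<otimes>\<^bsub>A\<^esub> f (inv\<^bsub>V\<^esub> x) x)"
  have b: "b \<in> carrier A" unfolding b_def using u by simp
  have "b \<otimes>\<^bsub>A\<^esub> a \<otimes>\<^bsub>A\<^esub> f (inv\<^bsub>V\<^esub> x) x = b \<otimes>\<^bsub>A\<^esub> (a \<otimes>\<^bsub>A\<^esub> f (inv\<^bsub>V\<^esub> x) x)"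
    using u b by (simp add: A.m_assoc)
  also have "\<dots> = \<one>\<^bsub>A\<^esub>" unfolding b_def using u by simp
  finally show "\<exists>v\<in>carrier (twisted_product A V f).
      v \<otimes>\<^bsub>twisted_product A V f\<^esub> u = \<one>\<^bsub>twisted_product A V f\<^esub>"
    using u b by (intro bexI[of _ "(b, inv\<^bsub>V\<^esub> x)"]) simp_all
qed auto

lemma twisted_product_nat_pow:
  assumes "a \<in> carrier A" "x \<in> carrier V"
  shows "(a, x) [^]\<^bsub>twisted_product A V f\<^esub> (k::nat) = (a [^]\<^bsub>A\<^esub> k, x [^]\<^bsub>V\<^esub> k)"
proof (induction k)
  case (Suc k)
  \<comment> \<open>Multiplying the \<open>k\<close>-th power by \<open>(a, x)\<close> on the right
    contributes the factor \<open>f (x^k) x\<close>, which is trivial.\<close>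
  then show ?case using assms
    by (simp add: nat_pow_Suc pow_trivial)
qed simp

lemma power_graph_iso_twisted_product: "power_graph_iso (A \<times>\<times> V) (twisted_product A V f)"
  by (rule power_graph_iso_if_same_powers) (auto simp: DirProd_nat_pow twisted_product_nat_pow)

lemma not_comm_group_twisted_product:
  assumes "x \<in> carrier V" "y \<in> carrier V" "f x y \<noteq> f y x"
  shows "\<not> comm_group (twisted_product A V f)"
proof
  assume "comm_group (twisted_product A V f)"
  then have "(\<one>\<^bsub>A\<^esub>, x) \<otimes>\<^bsub>twisted_product A V f\<^esub> (\<one>\<^bsub>A\<^esub>, y) =
      (\<one>\<^bsub>A\<^esub>, y) \<otimes>\<^bsub>twisted_product A V f\<^esub> (\<one>\<^bsub>A\<^esub>, x)"
    using assms by (intro comm_monoid.m_comm comm_group.axioms) simp_all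
  with assms show False by simp
qed

lemma order_notin_power_graph_determined_orders:
  assumes "comm_group V" "x \<in> carrier V" "y \<in> carrier V" "f x y \<noteq> f y x"
  shows "order A * order V \<notin> power_graph_determined_orders"
proof
  assume *: "order A * order V \<in> power_graph_determined_orders"
  have "comm_group (A \<times>\<times> V)"
    by (rule DirProd_comm_group) (use assms A.comm_group_axioms in auto)
  moreover have "A \<times>\<times> V \<cong> twisted_product A V f"
    by (rule power_graph_determined_orders_imp[OF *])
      (simp_all add: order_def card_cartesian_product group_twisted_product
        power_graph_iso_twisted_product DirProd_group A.is_group V.is_group)
  ultimately show False
    using comm_group.iso_imp_comm_group group.is_monoid group_twisted_product
      not_comm_group_twisted_product[OF assms(2-4)] by blast
qed

end

section \<open>Integer cocycles on (Z/q)^2 modulo s\<close>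

lemma order_integer_mod_group: "order (integer_mod_group n) = n"
  by (cases "n = 0") (simp_all add: order_def carrier_integer_mod_group)

text \<open>Multiplication by \<open>m\<close> embeds Z/s into Z/(s m). A cocycle modulo
  \<open>s\<close> thus gives one with values in the larger cyclic group, and a single
  \<open>c\<close> serves all multiples of \<open>s * q^2\<close>.\<close>

lemma mult_notin_power_graph_determined_orders:
  fixes c :: "int \<times> int \<Rightarrow> int \<times> int \<Rightarrow> int" and s q m :: nat
  defines "V \<equiv> {0..<int q} \<times> {0..<int q}"
    and "add \<equiv> \<lambda>(a, b) (a', b'). ((a + a') mod int q, (b + b') mod int q)"
  assumes pos: "s > 0" "q > 0" "m > 0"
    and cocycle: "\<And>x y z. \<lbrakk>x \<in> V; y \<in> V; z \<in> V\<rbrakk> \<Longrightarrow>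
      [c x y + c (add x y) z = c y z + c x (add y z)] (mod int s)"
    and pow_trivial: "\<And>a b k::nat. (int a, int b) \<in> V \<Longrightarrow>
      [c (int (k * a) mod int q, int (k * b) mod int q) (int a, int b) = 0] (mod int s)"
    and asym: "x \<in> V" "y \<in> V" "\<not> [c x y = c y x] (mod int s)"
  shows "s * m * q\<^sup>2 \<notin> power_graph_determined_orders"
proof -
  let ?A = "integer_mod_group (s * m)"
  let ?V = "integer_mod_group q \<times>\<times> integer_mod_group q"
  let ?f = "\<lambda>x y. (int m * c x y) mod int (s * m)"
  have scale: "(int m * a) mod int (s * m) = (int m * b) mod int (s * m) \<longleftrightarrow> [a = b] (mod int s)"
    for a b
    using pos by (simp add: cong_def mult.commute[of s] mult_mod_right[symmetric])
  have carrV: "carrier ?V = V"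
    using pos by (simp add: carrier_integer_mod_group V_def)
  have multV: "x \<otimes>\<^bsub>?V\<^esub> y = add x y" for x y
    by (cases x; cases y) (simp add: add_def)
  have V: "comm_group ?V" by (intro DirProd_comm_group) simp_all
  interpret A: comm_group ?A by simp
  interpret V: comm_group ?V by (rule V)
  interpret power_trivial_cocycle ?A ?V ?f
  proof
    fix x y z assume "x \<in> carrier ?V" "y \<in> carrier ?V" "z \<in> carrier ?V"
    then have "[c x y + c (add x y) z = c y z + c x (add y z)] (mod int s)"
      using cocycle carrV by simp
    then show "?f x y \<otimes>\<^bsub>?A\<^esub> ?f (x \<otimes>\<^bsub>?V\<^esub> y) z = ?f y z \<otimes>\<^bsub>?A\<^esub> ?f x (y \<otimes>\<^bsub>?V\<^esub> z)"
      unfolding multV scale[symmetric] by (simp only: mult_integer_mod_group mod_add_eq distrib_left)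
  next
    fix x and k :: nat assume x: "x \<in> carrier ?V"
    then obtain a b where ab: "x = (int a, int b)"
      unfolding carrV V_def by (auto elim!: nonneg_int_cases)
    have "[c (int (k * a) mod int q, int (k * b) mod int q) (int a, int b) = 0] (mod int s)"
      using pow_trivial x carrV ab by blast
    then show "?f (x [^]\<^bsub>?V\<^esub> k) x = \<one>\<^bsub>?A\<^esub>"
      unfolding scale[symmetric] by (simp add: ab DirProd_nat_pow)
  qed (use pos in \<open>simp add: carrier_integer_mod_group\<close>)
  have "order ?A * order ?V \<notin> power_graph_determined_orders"
    by (rule order_notin_power_graph_determined_orders[OF V])
      (use asym in \<open>simp_all only: carrV scale not_False_eq_True\<close>)
  moreover have "order ?V = q\<^sup>2"
    by (simp add: order_def card_cartesian_product power2_eq_square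
        order_integer_mod_group[unfolded order_def])
  ultimately show ?thesis by (simp only: order_integer_mod_group not_False_eq_True)
qed

section \<open>The determinant and Pauli cocycles\<close>

lemma cube_notin_power_graph_determined_orders:
  fixes p m :: nat
  assumes p: "p > 2" and m: "m > 0"
  shows "p ^ 3 * m \<notin> power_graph_determined_orders"
proof -
  \<comment> \<open>The determinant is bilinear, hence a cocycle, and alternating, hence zero on
    each pair (k x, x).\<close>
  let ?c = "\<lambda>(a, b) (a', b'). a * b' - a' * b :: int"
  have "p * m * p\<^sup>2 \<notin> power_graph_determined_orders"
  proof (rule mult_notin_power_graph_determined_orders[where c = ?c and x = "(1, 0)" and y = "(0, 1)"])
    \<comment> \<open>The two values are 1 and -1, and \<open>p > 2\<close> does not divide their
      difference 2.\<close>
    show "\<not> [?c (1, 0) (0, 1) = ?c (0, 1) (1, 0)] (mod int p)"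
      using p zdvd_imp_le[of "int p" 2] by (auto simp: cong_iff_dvd_diff)
  next
    fix a b k :: nat
    have "[(int (k * a) mod int p) * int b - int a * (int (k * b) mod int p)
        = int (k * a) * int b - int a * int (k * b)] (mod int p)"
      by (intro cong_diff cong_mult cong_refl) (simp_all add: cong_def)
    then show "[?c (int (k * a) mod int p, int (k * b) mod int p) (int a, int b) = 0] (mod int p)"
      by (simp add: algebra_simps)
  next
    fix x y z :: "int \<times> int"
    obtain a b where x: "x = (a, b)" by (cases x)
    obtain a' b' where y: "y = (a', b')" by (cases y)
    obtain a'' b'' where z: "z = (a'', b'')" by (cases z)
    \<comment> \<open>The inner reductions modulo \<open>p\<close> are dropped, the identity is
      verified over the integers by bilinearity, and the reductions are put back.\<close>
    have "[(a * b' - a' * b) + ((a + a') mod int p * b'' - a'' * ((b + b') mod int p))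
        = (a * b' - a' * b) + ((a + a') * b'' - a'' * (b + b'))] (mod int p)"
      by (intro cong_add cong_diff cong_mult cong_refl) (simp_all add: cong_def)
    also have "(a * b' - a' * b) + ((a + a') * b'' - a'' * (b + b'))
        = (a' * b'' - a'' * b') + (a * (b' + b'') - (a' + a'') * b)"
      by (simp add: algebra_simps)
    also have "[\<dots> = (a' * b'' - a'' * b')
        + (a * ((b' + b'') mod int p) - (a' + a'') mod int p * b)] (mod int p)"
      by (intro cong_add cong_diff cong_mult cong_refl) (simp_all add: cong_def)
    finally show "[?c x y + ?c ((case x of (a, b) \<Rightarrow> \<lambda>(a', b'). ((a + a') mod int p, (b + b') mod int p)) y) z
        = ?c y z + ?c x ((case y of (a, b) \<Rightarrow> \<lambda>(a', b'). ((a + a') mod int p, (b + b') mod int p)) z)] (mod int p)"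
      by (simp add: x y z)
  qed (use p m in auto)
  then show ?thesis by (simp add: power3_eq_cube power2_eq_square mult_ac)
qed

lemma sixteen_mult_notin_power_graph_determined_orders:
  fixes m :: nat
  assumes m: "m > 0"
  shows "2 ^ 4 * m \<notin> power_graph_determined_orders"
proof -
  \<comment> \<open>The Pauli matrices satisfy \<open>XY = \<i>Z\<close> and its cyclic permutations. The sign
    \<open>1 - 2 a b\<close> replaces \<open>(1, 1)\<close> by \<open>(-1, -1)\<close>, so that the three nonzero vectors sum to zero
    and all three cyclic determinants equal 1.\<close>
  let ?c = "\<lambda>(a, b) (a', b'). (1 - 2 * a * b) * (1 - 2 * a' * b') * (a * b' - a' * b) :: int"
  have V: "{0..<int 2} \<times> {0..<int 2} = {(0, 0), (0, 1), (1, 0), (1, 1)}"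
    by (auto simp: less_2_cases_iff)
  have "4 * m * 2\<^sup>2 \<notin> power_graph_determined_orders"
  proof (rule mult_notin_power_graph_determined_orders[where c = ?c and x = "(1, 0)" and y = "(0, 1)"])
    \<comment> \<open>The values 1 and -1 agree modulo 2 but not modulo 4; \<open>c\<close> is read
      as an exponent of the imaginary unit.\<close>
    show "\<not> [?c (1, 0) (0, 1) = ?c (0, 1) (1, 0)] (mod int 4)"
      by (simp add: cong_def)
  next
    fix a b k :: nat
    assume "(int a, int b) \<in> {0..<int 2} \<times> {0..<int 2}"
    then have "a = 0 \<or> a = 1" "b = 0 \<or> b = 1" by auto
    \<comment> \<open>The reduced multiple is zero or \<open>(a, b)\<close> itself, so the
      determinant factor vanishes.\<close>
    then show "[?c (int (k * a) mod int 2, int (k * b) mod int 2) (int a, int b) = 0] (mod int 4)"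
      by (auto simp: cong_def)
  next
    fix x y z :: "int \<times> int"
    assume "x \<in> {0..<int 2} \<times> {0..<int 2}" "y \<in> {0..<int 2} \<times> {0..<int 2}"
      "z \<in> {0..<int 2} \<times> {0..<int 2}"
    \<comment> \<open>All 64 triples are checked. The modulus matters: for (1, 0), (0, 1), (1, 0)
      the two sides are 2 and -2.\<close>
    then show "[?c x y + ?c ((case x of (a, b) \<Rightarrow> \<lambda>(a', b'). ((a + a') mod int 2, (b + b') mod int 2)) y) z
        = ?c y z + ?c x ((case y of (a, b) \<Rightarrow> \<lambda>(a', b'). ((a + a') mod int 2, (b + b') mod int 2)) z)] (mod int 4)"
      unfolding V by (elim insertE emptyE) (simp_all add: cong_def)
  qed (use m in auto)
  then show ?thesis by (simp add: mult_ac)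
qed

theorem theorem2p4:
  fixes n r \<alpha>\<^sub>0 :: nat
    and p \<alpha> :: "nat \<Rightarrow> nat"
  assumes "n = 2 ^ \<alpha>\<^sub>0 * (\<Prod>i = 1..r. p i ^ \<alpha> i)"
    and "\<forall>i \<in> {1..r}. Factorial_Ring.prime (p i) \<and> odd (p i)"
    and "inj_on p {1..r}"
    and "\<alpha>\<^sub>0 \<ge> 4 \<or> (\<exists>i \<in> {1..r}. \<alpha> i \<ge> 3)"
  shows "n \<notin> power_graph_determined_orders"
proof -
  \<comment> \<open>Positivity of \<open>n\<close> passes to the cofactor \<open>m\<close> in both
    cases.\<close>
  have n: "n > 0"
    using assms(1,2) by (auto intro!: prod_pos prime_gt_0_nat)
  from assms(4) show ?thesis
  proof
    assume "\<alpha>\<^sub>0 \<ge> 4"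
    then have "2 ^ 4 dvd n" unfolding assms(1) by (intro dvd_mult2 le_imp_power_dvd)
    then obtain m where m: "n = 2 ^ 4 * m" ..
    with n show ?thesis
      using sixteen_mult_notin_power_graph_determined_orders[of m] by simp
  next
    assume "\<exists>i \<in> {1..r}. \<alpha> i \<ge> 3"
    then obtain i where i: "i \<in> {1..r}" "\<alpha> i \<ge> 3" by blast
    have "p i ^ 3 dvd p i ^ \<alpha> i" by (rule le_imp_power_dvd[OF i(2)])
    also have "\<dots> dvd (\<Prod>i = 1..r. p i ^ \<alpha> i)" by (rule dvd_prodI) (use i in auto)
    finally have "p i ^ 3 dvd n" unfolding assms(1) by (rule dvd_mult)
    then obtain m where m: "n = p i ^ 3 * m" ..
    moreover have "p i > 2"
    proof -
      have "Factorial_Ring.prime (p i)" "odd (p i)" using assms(2) i(1) by blast+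
      then show ?thesis using prime_ge_2_nat[of "p i"] by (cases "p i = 2") auto
    qed
    ultimately show ?thesis
      using cube_notin_power_graph_determined_orders[of "p i" m] n by simp
  qed
qed

end
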